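(* Let $0\le q\le p\le 1$. In the system with $L$ sites and $n$ $1$'s, the steady state probability of $\tau\in\Omega_{L,n}$ with $\tau_1=\hat 1$ is given by $$\pi(\tau)=\frac{w(\tau)}{Z_{L,n}},\qquad\text{where}\qquad Z_{L,n}=Z_{L,n}(p,q)=\sum_{\tau\in\Omega_{L,n}}w(\tau)$$ is the (nonequilibrium) partition function or normalization factor.
   Context: Configurations: $\Omega_{L,n}$ is the set of words $\tau=(\tau_1,\dots,\tau_L)$ with letters in $\{0,1,\hat 1\}$ containing exactly one $\hat 1$ (the tracer particle), exactly $n$ letters $1$ (ordinary particles) and $L-n-1$ letters $0$ (vacancies). Sites are indexed periodically (mod $L$). Dynamics: a continuous-time Markov chain on $\Omega_{L,n}$ in which, for each bond $(i,i+1)$ with indices mod $L$, the contents of the two sites are exchanged as follows: $10\to 01$ at rate $1$, $01\to 10$ at rate $1$, $\hat 1 0\to 0\hat 1$ at rate $p$, $0\hat 1\to\hat 1 0$ at rate $q$; no other transitions occur. Steady state: $\pi$ denotes the steady state (stationary distribution) of this chain, which is taken to be unique; it is invariant under cyclic translation of configurations. Weights: for $\tau\in\Omega_{L,n}$ with $\tau_1=\hat 1$, $$w(\tau)=\prod_{\substack{2\le i\le L\\ \tau_i=0}}\bigl(1+p\,m_i(\tau)+q\,n_i(\tau)\bigr),$$ where $m_i(\tau)$ (resp. $n_i(\tau)$) is the number of $1$'s (not counting $\hat 1$) to the left (resp. right) of position $i$ in $\tau$. For arbitrary $\tau\in\Omega_{L,n}$, $w(\tau)$ is the weight of the unique cyclic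 rotation of $\tau$ whose first letter is $\hat 1$. *)

theory Defs
  imports "HOL-Probability.Probability_Mass_Function"
begin

datatype letter = Vacancy | Particle | Tracer

text \<open>
  Words are lists, so the site called \<open>i\<close> in the mathematics is position \<open>i - 1\<close> here,
  and \<open>\<tau>\<^sub>1\<close> is \<open>hd \<tau>\<close>.  The number of vacancies is written without truncated subtraction.
\<close>

definition configs :: "nat \<Rightarrow> nat \<Rightarrow> letter list set" where
  "configs L n = {\<tau>. length \<tau> = L \<and> count_list \<tau> Tracer = 1 \<and> count_list \<tau> Particle = n
                     \<and> count_list \<tau> Vacancy + n + 1 = L}"

text \<open>\<open>bond_rate p q a b\<close> is the rate of the exchange \<open>a b \<rightarrow> b a\<close> across a bond.\<close>

fun bond_rate :: "real \<Rightarrow> real \<Rightarrow> letter \<Rightarrow> letter \<Rightarrow> real" where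
  "bond_rate p q Particle Vacancy = 1"
| "bond_rate p q Vacancy Particle = 1"
| "bond_rate p q Tracer Vacancy = p"
| "bond_rate p q Vacancy Tracer = q"
| "bond_rate p q _ _ = 0"

definition next_site :: "nat \<Rightarrow> nat \<Rightarrow> nat" where
  "next_site L i = (i + 1) mod L"

definition exchange :: "nat \<Rightarrow> letter list \<Rightarrow> letter list" where
  "exchange i \<tau> = (let j = next_site (length \<tau>) i in \<tau>[i := \<tau> ! j, j := \<tau> ! i])"

text \<open>
  The rates of all bonds leading from \<open>\<sigma>\<close> to \<open>\<tau>\<close> are added up; for \<open>L = 2\<close> the two bonds
  \<open>(1,2)\<close> and \<open>(2,1)\<close> join the same pair of sites and both contribute.
\<close>

definition jump_rate :: "real \<Rightarrow> real \<Rightarrow> letter list \<Rightarrow> letter list \<Rightarrow> real" where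
  "jump_rate p q \<sigma> \<tau> =
     (\<Sum>i | i < length \<sigma> \<and> exchange i \<sigma> = \<tau>.
        bond_rate p q (\<sigma> ! i) (\<sigma> ! next_site (length \<sigma>) i))"

definition generator :: "nat \<Rightarrow> nat \<Rightarrow> real \<Rightarrow> real \<Rightarrow> letter list \<Rightarrow> letter list \<Rightarrow> real" where
  "generator L n p q \<sigma> \<tau> =
     (if \<sigma> = \<tau> then - (\<Sum>\<rho> \<in> configs L n - {\<sigma>}. jump_rate p q \<sigma> \<rho>)
      else jump_rate p q \<sigma> \<tau>)"

text \<open>Stationarity for a finite-state continuous-time chain: the row vector \<open>\<pi>\<close> satisfies \<open>\<pi> Q = 0\<close>.\<close>

definition stationary_distribution ::
    "nat \<Rightarrow> nat \<Rightarrow> real \<Rightarrow> real \<Rightarrow> letter list pmf \<Rightarrow> bool" where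
  "stationary_distribution L n p q \<pi> \<longleftrightarrow>
     set_pmf \<pi> \<subseteq> configs L n \<and>
     (\<forall>\<tau> \<in> configs L n. (\<Sum>\<sigma> \<in> configs L n. pmf \<pi> \<sigma> * generator L n p q \<sigma> \<tau>) = 0)"

definition translation_invariant :: "nat \<Rightarrow> nat \<Rightarrow> letter list pmf \<Rightarrow> bool" where
  "translation_invariant L n \<pi> \<longleftrightarrow> (\<forall>\<tau> \<in> configs L n. pmf \<pi> (rotate1 \<tau>) = pmf \<pi> \<tau>)"

definition particles_left :: "letter list \<Rightarrow> nat \<Rightarrow> nat" where
  "particles_left \<tau> i = card {j. j < i \<and> \<tau> ! j = Particle}"

definition particles_right :: "letter list \<Rightarrow> nat \<Rightarrow> nat" where
  "particles_right \<tau> i = card {j. i < j \<and> j < length \<tau> \<and> \<tau> ! j = Particle}"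

definition tracer_first_weight :: "real \<Rightarrow> real \<Rightarrow> letter list \<Rightarrow> real" where
  "tracer_first_weight p q \<tau> =
     (\<Prod>i | 1 \<le> i \<and> i < length \<tau> \<and> \<tau> ! i = Vacancy.
        1 + p * real (particles_left \<tau> i) + q * real (particles_right \<tau> i))"

definition tracer_first_rotation :: "letter list \<Rightarrow> letter list" where
  "tracer_first_rotation \<tau> = (THE \<sigma>. (\<exists>k. \<sigma> = rotate k \<tau>) \<and> hd \<sigma> = Tracer)"

definition weight :: "real \<Rightarrow> real \<Rightarrow> letter list \<Rightarrow> real" where
  "weight p q \<tau> = tracer_first_weight p q (tracer_first_rotation \<tau>)"

definition partition_function :: "nat \<Rightarrow> nat \<Rightarrow> real \<Rightarrow> real \<Rightarrow> real" where
  "partition_function L n p q = (\<Sum>\<tau> \<in> configs L n. weight p q \<tau>)"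

end

theory Submission
  imports Defs
begin

text \<open>
  Stationarity of the weights reduces, by rotation, to words beginning with the tracer.  Deleting a
  vacancy from such a word gives a weight \<open>c\<^sub>i\<close> (put \<open>c\<^sub>i = 0\<close> if site \<open>i\<close> is occupied), and the net flow
  through the bulk bond \<open>(i, i + 1)\<close> is \<open>(p - q) (c\<^sub>i - c\<^sub>i\<^sub>+\<^sub>1)\<close>.  These flows telescope, and the two
  ends are cancelled by the flows through the two bonds at the tracer.

  For uniqueness, let \<open>M\<close> be the maximum of \<open>\<pi> / w\<close>.  Then \<open>M w - \<pi>\<close> is nonnegative and stationary
  and has a zero, and its zero set is closed under predecessors.  Exchanges of particles and vacancies
  connect all words with the tracer at a given site; a step of the tracer
  (if \<open>p > 0\<close> and there is a vacancy) or translation invariance moves on to the next site.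
\<close>

section \<open>Configurations and exchanges\<close>

lemma in_configs_cong_mset:
  assumes "mset \<sigma> = mset \<tau>"
  shows "\<sigma> \<in> configs L n \<longleftrightarrow> \<tau> \<in> configs L n"
  using assms mset_eq_length[OF assms] by (simp add: configs_def flip: count_mset)

lemma configs_mset_eq:
  assumes "\<sigma> \<in> configs L n" "\<tau> \<in> configs L n"
  shows "mset \<sigma> = mset \<tau>"
proof (rule multiset_eqI)
  fix x
  show "count (mset \<sigma>) x = count (mset \<tau>) x"
    using assms by (cases x) (auto simp: configs_def count_mset)
qed

lemma length_configs: "\<tau> \<in> configs L n \<Longrightarrow> length \<tau> = L"
  by (simp add: configs_def)

lemma finite_configs: "finite (configs L n)"
proof -
  have "(UNIV :: letter set) = {Vacancy, Particle, Tracer}"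
    using letter.exhaust by blast
  hence "finite (UNIV :: letter set)"
    by (metis finite.emptyI finite.insertI)
  hence "finite {xs :: letter list. set xs \<subseteq> UNIV \<and> length xs = L}"
    by (rule finite_lists_length_eq)
  thus ?thesis
    by (rule rev_finite_subset) (auto simp: configs_def)
qed

lemma next_site_less: "i < L \<Longrightarrow> next_site L i < L"
  by (simp add: next_site_def)

lemma length_exchange [simp]: "length (exchange i \<tau>) = length \<tau>"
  by (simp add: exchange_def Let_def)

lemma mset_exchange: "i < length \<tau> \<Longrightarrow> mset (exchange i \<tau>) = mset \<tau>"
  by (simp add: exchange_def Let_def next_site_less mset_swap)

lemma exchange_in_configs:
  "i < L \<Longrightarrow> \<tau> \<in> configs L n \<Longrightarrow> exchange i \<tau> \<in> configs L n"
  using in_configs_cong_mset[OF mset_exchange] length_configs by blast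

lemma rotate1_in_configs: "rotate1 \<tau> \<in> configs L n \<longleftrightarrow> \<tau> \<in> configs L n"
  by (rule in_configs_cong_mset) (cases \<tau>; simp)

lemma rotate_in_configs: "rotate k \<tau> \<in> configs L n \<longleftrightarrow> \<tau> \<in> configs L n"
  by (induction k) (simp_all add: rotate1_in_configs)

lemma exchange_nth:
  assumes "i < length \<tau>"
  shows "exchange i \<tau> ! i = \<tau> ! next_site (length \<tau>) i"
    and "exchange i \<tau> ! next_site (length \<tau>) i = \<tau> ! i"
  using assms by (auto simp: exchange_def Let_def nth_list_update next_site_less)

text \<open>Swapping twice restores both sites. Hence through bond \<open>i\<close> the word \<tau>
  has the single predecessor \<open>exchange i \<tau>\<close>, and inflow can be summed over bonds
  instead of source words.\<close>

lemma exchange_exchange: "i < length \<tau> \<Longrightarrow> exchange i (exchange i \<tau>) = \<tau>"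
  by (rule nth_equalityI)
    (auto simp: exchange_def Let_def nth_list_update next_site_less)

lemma exchange_append:
  "exchange (length xs) (xs @ a # b # ys) = xs @ b # a # ys"
  by (simp add: exchange_def Let_def next_site_def nth_append list_update_append)

lemma exchange_last:
  "exchange (Suc (length xs)) (a # xs @ [b]) = b # xs @ [a]"
  by (simp add: exchange_def Let_def next_site_def nth_append list_update_append)

lemma nth_rotate1_next: "i < length \<tau> \<Longrightarrow> rotate1 \<tau> ! i = \<tau> ! next_site (length \<tau>) i"
  by (simp add: nth_rotate1 next_site_def)

lemma inj_on_next_site: "inj_on (next_site L) {..<L}"
  by (rule inj_onI) (auto simp: next_site_def mod_Suc split: if_splits)

lemma bij_betw_next_site: "bij_betw (next_site L) {..<L} {..<L}"
  using inj_on_next_site[of L]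
  by (metis bij_betw_imageI endo_inj_surj finite_lessThan image_subsetI lessThan_iff next_site_less)

text \<open>\<open>rotate1\<close> brings the letter of site
  \<open>next_site (length \<tau>) i\<close> to site \<open>i\<close>, so bond \<open>i\<close> of
  the rotated word is the following bond of the original one.\<close>

lemma exchange_rotate1:
  assumes "i < length \<tau>"
  shows "exchange i (rotate1 \<tau>) = rotate1 (exchange (next_site (length \<tau>) i) \<tau>)"
proof (rule nth_equalityI)
  let ?s = "next_site (length \<tau>)"
  fix k assume "k < length (exchange i (rotate1 \<tau>))"
  hence k: "k < length \<tau>" by simp
  have inj: "?s a = ?s b \<longleftrightarrow> a = b" if "a < length \<tau>" "b < length \<tau>" for a b
    using inj_on_eq_iff[OF inj_on_next_site] that by blast
  show "exchange i (rotate1 \<tau>) ! k = rotate1 (exchange (?s i) \<tau>) ! k"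
    using assms k
    by (simp add: nth_rotate1_next exchange_def Let_def nth_list_update next_site_less inj)
qed simp

section \<open>Net flow\<close>

text \<open>The master equation at \<tau>, written bond by bond. Bonds that leave \<tau> unchanged
  may stay in the sum: they join equal letters, whose rate is 0.\<close>

definition net_flow :: "real \<Rightarrow> real \<Rightarrow> (letter list \<Rightarrow> real) \<Rightarrow> letter list \<Rightarrow> real" where
  "net_flow p q g \<tau> = (\<Sum>i<length \<tau>.
     g (exchange i \<tau>) * bond_rate p q (\<tau> ! next_site (length \<tau>) i) (\<tau> ! i)
     - g \<tau> * bond_rate p q (\<tau> ! i) (\<tau> ! next_site (length \<tau>) i))"

text \<open>After the order of summation is swapped, each bond has the single target
  \<open>exchange i \<sigma>\<close>, which is excluded exactly when it equals \<sigma>.\<close>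

lemma sum_jump_rate:
  assumes "\<sigma> \<in> configs L n"
  shows "(\<Sum>\<rho>\<in>configs L n - {\<sigma>}. jump_rate p q \<sigma> \<rho>) =
    (\<Sum>i<L. if exchange i \<sigma> = \<sigma> then 0 else bond_rate p q (\<sigma> ! i) (\<sigma> ! next_site L i))"
proof -
  have len: "length \<sigma> = L" using assms by (rule length_configs)
  have "(\<Sum>\<rho>\<in>configs L n - {\<sigma>}. jump_rate p q \<sigma> \<rho>) =
    (\<Sum>\<rho>\<in>configs L n - {\<sigma>}. \<Sum>i<L.
       if exchange i \<sigma> = \<rho> then bond_rate p q (\<sigma> ! i) (\<sigma> ! next_site L i) else 0)"
    unfolding jump_rate_def len
    by (simp add: lessThan_def flip: sum.inter_filter)
  also have "\<dots> = (\<Sum>i<L. \<Sum>\<rho>\<in>configs L n - {\<sigma>}.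
       if exchange i \<sigma> = \<rho> then bond_rate p q (\<sigma> ! i) (\<sigma> ! next_site L i) else 0)"
    by (rule sum.swap)
  also have "\<dots> = (\<Sum>i<L. if exchange i \<sigma> = \<sigma> then 0 else bond_rate p q (\<sigma> ! i) (\<sigma> ! next_site L i))"
    using assms by (intro sum.cong refl) (simp add: finite_configs exchange_in_configs)
  finally show ?thesis .
qed

lemma sum_inflow:
  assumes "\<tau> \<in> configs L n"
  shows "(\<Sum>\<sigma>\<in>configs L n - {\<tau>}. g \<sigma> * jump_rate p q \<sigma> \<tau>) =
    (\<Sum>i<L. if exchange i \<tau> = \<tau> then 0
       else g (exchange i \<tau>) * bond_rate p q (\<tau> ! next_site L i) (\<tau> ! i))"
proof -
  have len: "length \<tau> = L" using assms by (rule length_configs)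
  \<comment> \<open>Exchanges are involutions, so the bonds leading from \<sigma> to \<tau> are
    those leading from \<tau> to \<sigma>, with the two letters in the opposite order.\<close>
  have jump: "jump_rate p q \<sigma> \<tau> =
      (\<Sum>i<L. if \<sigma> = exchange i \<tau> then bond_rate p q (\<tau> ! next_site L i) (\<tau> ! i) else 0)"
    if "\<sigma> \<in> configs L n" for \<sigma>
  proof -
    have len': "length \<sigma> = L" using that by (rule length_configs)
    have "jump_rate p q \<sigma> \<tau> =
      (\<Sum>i | i \<in> {..<L} \<and> \<sigma> = exchange i \<tau>. bond_rate p q (\<tau> ! next_site L i) (\<tau> ! i))"
      unfolding jump_rate_def len'
    proof (intro sum.cong)
      show "{i. i < L \<and> exchange i \<sigma> = \<tau>} = {i \<in> {..<L}. \<sigma> = exchange i \<tau>}"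
        using len len' by (auto simp: exchange_exchange)
    qed (use len exchange_nth[of _ \<tau>] in auto)
    thus ?thesis by (simp add: lessThan_def flip: sum.inter_filter)
  qed
  have "(\<Sum>\<sigma>\<in>configs L n - {\<tau>}. g \<sigma> * jump_rate p q \<sigma> \<tau>) =
    (\<Sum>\<sigma>\<in>configs L n - {\<tau>}. \<Sum>i<L.
       if \<sigma> = exchange i \<tau> then g \<sigma> * bond_rate p q (\<tau> ! next_site L i) (\<tau> ! i) else 0)"
    by (intro sum.cong refl) (auto simp: jump sum_distrib_left intro!: sum.cong)
  also have "\<dots> = (\<Sum>i<L. \<Sum>\<sigma>\<in>configs L n - {\<tau>}.
       if \<sigma> = exchange i \<tau> then g \<sigma> * bond_rate p q (\<tau> ! next_site L i) (\<tau> ! i) else 0)"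
    by (rule sum.swap)
  also have "\<dots> = (\<Sum>i<L. if exchange i \<tau> = \<tau> then 0
       else g (exchange i \<tau>) * bond_rate p q (\<tau> ! next_site L i) (\<tau> ! i))"
    using assms by (intro sum.cong refl) (simp add: finite_configs exchange_in_configs)
  finally show ?thesis .
qed

lemma sum_generator_eq_net_flow:
  assumes "\<tau> \<in> configs L n"
  shows "(\<Sum>\<sigma>\<in>configs L n. g \<sigma> * generator L n p q \<sigma> \<tau>) = net_flow p q g \<tau>"
proof -
  have len: "length \<tau> = L" using assms by (rule length_configs)
  have fixed: "\<tau> ! next_site L i = \<tau> ! i" if "exchange i \<tau> = \<tau>" "i < L" for i
    using exchange_nth(1)[of i \<tau>] that len by simp
  have "(\<Sum>\<sigma>\<in>configs L n. g \<sigma> * generator L n p q \<sigma> \<tau>) =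
    g \<tau> * generator L n p q \<tau> \<tau> + (\<Sum>\<sigma>\<in>configs L n - {\<tau>}. g \<sigma> * jump_rate p q \<sigma> \<tau>)"
    by (subst sum.remove[OF finite_configs assms]) (simp add: generator_def)
  also have "\<dots> = net_flow p q g \<tau>"
    unfolding generator_def net_flow_def len
    by (simp add: sum_inflow[OF assms] sum_jump_rate[OF assms] sum_distrib_left
        flip: sum_subtractf sum.distrib sum_negf)
      (intro sum.cong refl, auto simp: fixed)
  finally show ?thesis .
qed

text \<open>The dynamics commutes with translation: the bonds are relabelled by the bijection
  \<open>next_site\<close>.\<close>

lemma net_flow_rotate1: "net_flow p q g (rotate1 \<tau>) = net_flow p q (g \<circ> rotate1) \<tau>"
proof -
  let ?s = "next_site (length \<tau>)"
  have "net_flow p q (g \<circ> rotate1) \<tau> = (\<Sum>i<length \<tau>.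
      g (rotate1 (exchange (?s i) \<tau>)) * bond_rate p q (\<tau> ! ?s (?s i)) (\<tau> ! ?s i)
      - g (rotate1 \<tau>) * bond_rate p q (\<tau> ! ?s i) (\<tau> ! ?s (?s i)))"
    unfolding net_flow_def
    by (subst sum.reindex_bij_betw[OF bij_betw_next_site, symmetric]) simp
  also have "\<dots> = net_flow p q g (rotate1 \<tau>)"
    unfolding net_flow_def
    by (intro sum.cong) (simp_all add: nth_rotate1_next next_site_less exchange_rotate1)
  finally show ?thesis by simp
qed

lemma net_flow_rotate: "net_flow p q g (rotate k \<tau>) = net_flow p q (g \<circ> rotate k) \<tau>"
proof (induction k arbitrary: g)
  case (Suc k)
  have "net_flow p q g (rotate (Suc k) \<tau>) = net_flow p q (g \<circ> rotate1) (rotate k \<tau>)"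
    by (simp add: net_flow_rotate1)
  also have "\<dots> = net_flow p q (g \<circ> rotate (Suc k)) \<tau>"
    by (simp add: Suc.IH o_def)
  finally show ?case .
qed (simp add: rotate_def o_def)

lemma net_flow_linear:
  "net_flow p q (\<lambda>\<sigma>. M * g \<sigma> - h \<sigma>) \<tau> = M * net_flow p q g \<tau> - net_flow p q h \<tau>"
  unfolding net_flow_def sum_distrib_left sum_subtractf[symmetric]
  by (intro sum.cong refl) (simp add: algebra_simps)

section \<open>Stationarity of the weights\<close>

lemma tracer_first_rotation_rotate1:
  "tracer_first_rotation (rotate1 \<tau>) = tracer_first_rotation \<tau>"
proof -
  have "(\<exists>k. \<sigma> = rotate k (rotate1 \<tau>)) \<longleftrightarrow> (\<exists>k. \<sigma> = rotate k \<tau>)" for \<sigma>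
  proof
    assume "\<exists>k. \<sigma> = rotate k \<tau>"
    then obtain k where k: "\<sigma> = rotate k \<tau>" by blast
    show "\<exists>k. \<sigma> = rotate k (rotate1 \<tau>)"
    proof (cases "\<tau> = []")
      case False
      \<comment> \<open>Rotating by \<open>length \<tau> - 1\<close> more steps undoes one
        \<open>rotate1\<close> with a natural exponent.\<close>
      hence "k + (length \<tau> - 1) + 1 = k + length \<tau>"
        by (cases \<tau>) auto
      moreover have "rotate (k + (length \<tau> - 1)) (rotate1 \<tau>) = rotate (k + (length \<tau> - 1) + 1) \<tau>"
        using rotate_rotate[of "k + (length \<tau> - 1)" 1 \<tau>] by simp
      moreover have "rotate (k + length \<tau>) \<tau> = \<sigma>"
        using k rotate_conv_mod[of "k + length \<tau>" \<tau>] rotate_conv_mod[of k \<tau>] by simp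
      ultimately show ?thesis by metis
    qed (use k in simp)
  next
    assume "\<exists>k. \<sigma> = rotate k (rotate1 \<tau>)"
    then obtain k where "\<sigma> = rotate k (rotate1 \<tau>)" by blast
    hence "\<sigma> = rotate (k + 1) \<tau>"
      using rotate_rotate[of k 1 \<tau>] by simp
    thus "\<exists>k. \<sigma> = rotate k \<tau>" by blast
  qed
  thus ?thesis by (simp add: tracer_first_rotation_def)
qed

lemma weight_rotate1: "weight p q (rotate1 \<tau>) = weight p q \<tau>"
  by (simp add: weight_def tracer_first_rotation_rotate1)

lemma weight_rotate: "weight p q (rotate k \<tau>) = weight p q \<tau>"
  by (induction k) (simp_all add: weight_rotate1)

text \<open>The tracer stands only at position 0, so a rotation that begins with it is by a multiple
  of the length. This is the uniqueness behind \<open>THE\<close>.\<close>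

lemma tracer_first_rotation_Cons:
  assumes "Tracer \<notin> set u"
  shows "tracer_first_rotation (Tracer # u) = Tracer # u"
  unfolding tracer_first_rotation_def
proof (rule the_equality)
  show "(\<exists>k. Tracer # u = rotate k (Tracer # u)) \<and> hd (Tracer # u) = Tracer"
    by (metis list.sel(1) rotate0 id_apply)
next
  fix \<sigma> assume "(\<exists>k. \<sigma> = rotate k (Tracer # u)) \<and> hd \<sigma> = Tracer"
  then obtain k where k: "\<sigma> = rotate k (Tracer # u)" "hd \<sigma> = Tracer" by blast
  hence "(Tracer # u) ! (k mod length (Tracer # u)) = Tracer"
    by (metis hd_rotate_conv_nth list.distinct(1))
  moreover have "k mod length (Tracer # u) < length (Tracer # u)" by simp
  ultimately have "k mod length (Tracer # u) = 0"
    using assms by (metis gr0_conv_Suc length_Cons not_less_eq nth_Cons_Suc nth_mem not_gr_zero)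
  thus "\<sigma> = Tracer # u"
    using k(1) by (metis rotate_conv_mod rotate0 id_apply)
qed

section \<open>The weight as a recursive product\<close>

text \<open>Here \<open>m\<close> counts the particles already passed. Unlike the product over
  positions, this form splits over concatenation, so the effect of a local exchange can be
  computed.\<close>

fun vacancy_prod :: "(nat \<Rightarrow> real) \<Rightarrow> nat \<Rightarrow> letter list \<Rightarrow> real" where
  "vacancy_prod f m [] = 1"
| "vacancy_prod f m (Vacancy # u) = f m * vacancy_prod f m u"
| "vacancy_prod f m (Particle # u) = vacancy_prod f (Suc m) u"
| "vacancy_prod f m (Tracer # u) = vacancy_prod f m u"

lemma vacancy_prod_append:
  "vacancy_prod f m (u @ v) = vacancy_prod f m u * vacancy_prod f (m + count_list u Particle) v"
  by (induction f m u rule: vacancy_prod.induct) simp_all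

lemma particles_left_append:
  "i \<le> length u \<Longrightarrow> particles_left (u @ v) i = particles_left u i"
  unfolding particles_left_def by (rule arg_cong[where f = card]) (auto simp: nth_append)

lemma particles_left_length: "particles_left u (length u) = count_list u Particle"
  unfolding particles_left_def
  by (simp add: count_list_eq_length_filter length_filter_conv_card eq_commute)

text \<open>Induction from the right: a letter appended at the end leaves all earlier left counts
  unchanged and adds at most one factor.\<close>

lemma prod_particles_left:
  "(\<Prod>i | i < length u \<and> u ! i = Vacancy. f (particles_left u i)) = vacancy_prod f 0 u"
proof (induction u rule: rev_induct)
  case (snoc x u)
  have eq: "{i. i < length (u @ [x]) \<and> (u @ [x]) ! i = Vacancy} =
      (if x = Vacancy then {length u} else {}) \<union> {i. i < length u \<and> u ! i = Vacancy}"
    by (auto simp: nth_append less_Suc_eq)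
  have "(\<Prod>i | i < length u \<and> u ! i = Vacancy. f (particles_left (u @ [x]) i)) =
      vacancy_prod f 0 u"
    unfolding snoc.IH[symmetric] by (intro prod.cong) (simp_all add: particles_left_append)
  thus ?case
    unfolding eq
    by (cases x) (simp_all add: vacancy_prod_append particles_left_append particles_left_length)
qed simp

lemma particles_left_right:
  assumes "i < length \<tau>" "\<tau> ! i \<noteq> Particle"
  shows "particles_left \<tau> i + particles_right \<tau> i = count_list \<tau> Particle"
proof -
  have "count_list \<tau> Particle = card {j. j < length \<tau> \<and> \<tau> ! j = Particle}"
    by (simp add: count_list_eq_length_filter length_filter_conv_card eq_commute)
  also have "{j. j < length \<tau> \<and> \<tau> ! j = Particle} =
      {j. j < i \<and> \<tau> ! j = Particle} \<union> {j. i < j \<and> j < length \<tau> \<and> \<tau> ! j = Particle}"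
    using assms by (auto simp: not_less_iff_gr_or_eq)
  also have "card \<dots> = particles_left \<tau> i + particles_right \<tau> i"
    unfolding particles_left_def particles_right_def by (rule card_Un_disjoint) auto
  finally show ?thesis by simp
qed

text \<open>The left and right counts at a vacancy add up to \<open>n\<close>, so each factor
  depends on the left count alone.\<close>

lemma weight_Tracer_Cons:
  assumes "Tracer \<notin> set u" "count_list u Particle = n"
  shows "weight p q (Tracer # u) =
    vacancy_prod (\<lambda>m. 1 + p * real m + q * (real n - real m)) 0 u"
proof -
  let ?f = "\<lambda>m. 1 + p * real m + q * (real n - real m)"
  let ?\<tau> = "Tracer # u"
  have "weight p q ?\<tau> = (\<Prod>i | 1 \<le> i \<and> i < length ?\<tau> \<and> ?\<tau> ! i = Vacancy.
      1 + p * real (particles_left ?\<tau> i) + q * real (particles_right ?\<tau> i))"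
    by (simp add: weight_def tracer_first_rotation_Cons[OF assms(1)] tracer_first_weight_def)
  also have "\<dots> = (\<Prod>i | i < length ?\<tau> \<and> ?\<tau> ! i = Vacancy. ?f (particles_left ?\<tau> i))"
  proof (rule prod.cong)
    show "{i. 1 \<le> i \<and> i < length ?\<tau> \<and> ?\<tau> ! i = Vacancy} = {i. i < length ?\<tau> \<and> ?\<tau> ! i = Vacancy}"
      by (auto simp: Suc_le_eq intro: gr0I)
  next
    fix i assume "i \<in> {i. i < length ?\<tau> \<and> ?\<tau> ! i = Vacancy}"
    hence "particles_left ?\<tau> i + particles_right ?\<tau> i = n"
      using particles_left_right[of i ?\<tau>] assms(2) by simp
    hence "real (particles_right ?\<tau> i) = real n - real (particles_left ?\<tau> i)"
      by linarith
    thus "1 + p * real (particles_left ?\<tau> i) + q * real (particles_right ?\<tau> i) =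
        ?f (particles_left ?\<tau> i)"
      by simp
  qed
  also have "\<dots> = vacancy_prod ?f 0 u"
    by (subst prod_particles_left) simp
  finally show ?thesis .
qed

lemma weight_pos:
  assumes "0 \<le> p" "0 \<le> q"
  shows "0 < weight p q \<tau>"
  unfolding weight_def tracer_first_weight_def
  using assms by (intro prod_pos) (auto intro!: add_pos_nonneg mult_nonneg_nonneg)

section \<open>Cancellation of the flows around the ring\<close>

text \<open>Bonds 0 and \<open>length u\<close> touch the tracer; bond \<open>Suc i\<close> joins
  letters \<open>i\<close> and \<open>Suc i\<close> of \<open>u\<close>. The cancellation rests on
  \<open>f (m + 1) - f m = p - q\<close> and \<open>p * f 0 - q * f n = p - q\<close>.\<close>

lemma net_flow_weight_Tracer_Cons:
  assumes u: "Tracer \<notin> set u"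
  shows "net_flow p q (weight p q) (Tracer # u) = 0"
proof (cases "u = []")
  case True
  thus ?thesis by (simp add: net_flow_def next_site_def)
next
  case False
  define n where "n = count_list u Particle"
  define f where "f = (\<lambda>m. 1 + p * real m + q * (real n - real m))"
  let ?V = "vacancy_prod f 0"
  let ?\<tau> = "Tracer # u"
  define c where "c i = (if u ! i = Vacancy then ?V (take i u @ drop (Suc i) u) else 0)" for i
  define t where "t i = weight p q (exchange i ?\<tau>) *
       bond_rate p q (?\<tau> ! next_site (length ?\<tau>) i) (?\<tau> ! i)
     - weight p q ?\<tau> * bond_rate p q (?\<tau> ! i) (?\<tau> ! next_site (length ?\<tau>) i)" for i
  \<comment> \<open>Rearranging \<open>u\<close> preserves \<open>n\<close>, so one \<open>f\<close>
    serves for all words that occur.\<close>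
  have W: "weight p q (Tracer # v) = ?V v" if "mset v = mset u" for v
    unfolding f_def
    using that u by (intro weight_Tracer_Cons) (auto simp: n_def dest: mset_eq_setD simp flip: count_mset)
  \<comment> \<open>If the first letter of \<open>u\<close> is a vacancy, the exchange followed by
    rotation puts it last: its factor changes from \<open>f 0\<close> to \<open>f n\<close>. At the
    last bond the change is the reverse.\<close>
  have first: "t 0 = (q - p) * c 0"
  proof -
    obtain a u' where u': "u = a # u'" using False by (cases u) auto
    have ex: "exchange 0 ?\<tau> = a # Tracer # u'"
      using exchange_append[of "[]"] u' by simp
    have "weight p q (a # Tracer # u') = weight p q (Tracer # u' @ [a])"
      using weight_rotate1[of p q "a # Tracer # u'"] by simp
    also have "\<dots> = ?V (u' @ [a])" using u' by (intro W) simp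
    finally have "weight p q (exchange 0 ?\<tau>) = ?V (u' @ [a])" by (simp add: ex)
    thus ?thesis
      using u u' W[of u]
      by (cases a) (simp_all add: t_def c_def next_site_def vacancy_prod_append f_def n_def algebra_simps)
  qed
  have last: "t (length u) = (p - q) * c (length u - 1)"
  proof -
    obtain b u' where u': "u = u' @ [b]" using False by (cases u rule: rev_cases) auto
    have ex: "exchange (length u) ?\<tau> = b # u' @ [Tracer]"
      using exchange_last[of u' Tracer b] u' by simp
    have "weight p q (b # u' @ [Tracer]) = weight p q (Tracer # b # u')"
      using weight_rotate1[of p q "Tracer # b # u'"] by simp
    also have "\<dots> = ?V (b # u')" using u' by (intro W) simp
    finally have "weight p q (exchange (length u) ?\<tau>) = ?V (b # u')" by (simp only: ex)
    thus ?thesis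
      using u u' W[of u]
      by (cases b) (simp_all add: t_def c_def next_site_def vacancy_prod_append f_def n_def
          nth_append algebra_simps)
  qed
  \<comment> \<open>For unlike letters the two words differ in one factor, by \<open>p - q\<close>,
    and \<open>c = 0\<close> at the particle gives the right sign. For two vacancies both deletions
    yield the same word, so the difference vanishes.\<close>
  have bulk: "t (Suc i) = (p - q) * (c i - c (Suc i))" if i: "i < length u - 1" for i
  proof -
    define xs ys where "xs = take i u" and "ys = drop (Suc (Suc i)) u"
    obtain a b where ab: "u = xs @ a # b # ys" and len: "length xs = i"
      using i unfolding xs_def ys_def
      by (metis Cons_nth_drop_Suc One_nat_def Suc_lessD Suc_lessI append_take_drop_id length_take
          less_diff_conv add.commute plus_1_eq_Suc min.absorb2 less_imp_le_nat min.commute)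
    have "exchange (Suc i) ?\<tau> = Tracer # xs @ b # a # ys"
      using exchange_append[of "Tracer # xs" a b ys] ab len by simp
    moreover have "weight p q (Tracer # xs @ b # a # ys) = ?V (xs @ b # a # ys)"
      using ab by (intro W) simp
    moreover have "next_site (length ?\<tau>) (Suc i) = Suc (Suc i)"
      using i by (simp add: next_site_def)
    moreover have "u ! i = a" "u ! Suc i = b" "take i u = xs" "drop (Suc i) u = b # ys"
      "take (Suc i) u = xs @ [a]" "drop (Suc (Suc i)) u = ys"
      using ab len by (auto simp: nth_append)
    moreover have "a \<noteq> Tracer" "b \<noteq> Tracer" using u ab by auto
    ultimately show ?thesis
      using W[of u] ab
      by (cases a; cases b) (simp_all add: t_def c_def vacancy_prod_append f_def algebra_simps)
  qed
  have "net_flow p q (weight p q) ?\<tau> = (\<Sum>i<Suc (length u). t i)"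
    by (simp add: net_flow_def t_def)
  also have "\<dots> = t 0 + (\<Sum>i<length u - 1. t (Suc i)) + t (length u)"
  proof -
    obtain k where "length u = Suc k" using False by (cases u) auto
    thus ?thesis
      using sum.lessThan_Suc_shift[of t k] by simp
  qed
  also have "(\<Sum>i<length u - 1. t (Suc i)) = (p - q) * (c 0 - c (length u - 1))"
    using bulk by (simp add: sum_lessThan_telescope' flip: sum_distrib_left)
  finally show ?thesis by (simp add: first last algebra_simps)
qed

lemma configs_obtain_rotate:
  assumes "\<tau> \<in> configs L n"
  obtains k u where "\<tau> = rotate k (Tracer # u)" "Tracer \<notin> set u" "Tracer # u \<in> configs L n"
proof -
  have "Tracer \<in> set \<tau>"
    using assms by (auto simp: configs_def intro: ccontr)
  then obtain xs ys where s: "\<tau> = xs @ Tracer # ys" by (auto dest: split_list)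
  hence r: "\<tau> = rotate (Suc (length ys)) (Tracer # (ys @ xs))"
    using rotate_append[of "Tracer # ys" xs] by simp
  moreover have "Tracer # (ys @ xs) \<in> configs L n"
    using assms r rotate_in_configs by metis
  moreover from this have "Tracer \<notin> set (ys @ xs)"
    by (simp add: configs_def count_list_0_iff)
  ultimately show thesis using that by blast
qed

lemma net_flow_weight:
  assumes "\<tau> \<in> configs L n"
  shows "net_flow p q (weight p q) \<tau> = 0"
proof -
  obtain k u where "\<tau> = rotate k (Tracer # u)" "Tracer \<notin> set u"
    using configs_obtain_rotate[OF assms] by metis
  moreover have "weight p q \<circ> rotate k = weight p q"
    by (simp add: fun_eq_iff weight_rotate)
  ultimately show ?thesis
    by (simp add: net_flow_rotate net_flow_weight_Tracer_Cons)
qed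

section \<open>Uniqueness\<close>

text \<open>Bubble the first letter of \<open>v\<close> to the front of \<open>u\<close> and recurse
  on the tails. Swaps are assumed only for rearrangements of \<open>u\<close>, so membership in
  \<open>configs\<close> can be used when they are justified.\<close>

lemma mset_eq_adjacent_swaps:
  assumes "mset u = mset v" "P u"
    and "\<And>xs a b ys. mset (xs @ a # b # ys) = mset u \<Longrightarrow> P (xs @ a # b # ys) \<Longrightarrow> P (xs @ b # a # ys)"
  shows "P v"
  using assms
proof (induction v arbitrary: u P)
  case (Cons b v)
  then obtain xs ys where s: "u = xs @ b # ys"
    by (metis list.set_intros(1) mset_eq_setD split_list)
  have "P (b # xs' @ ys')" if "mset (xs' @ b # ys') = mset u" "P (xs' @ b # ys')" for xs' ys'
    using that
  proof (induction xs' arbitrary: ys' rule: rev_induct)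
    case (snoc a xs')
    have "P (xs' @ b # a # ys')"
      by (rule Cons.prems(3)) (use snoc.prems in simp_all)
    thus ?case
      using snoc.IH[of "a # ys'"] snoc.prems by (simp add: add_mset_commute)
  qed simp
  hence "P (b # xs @ ys)"
    using Cons.prems(2) s by simp
  moreover have "P (b # zs @ d # c # ws)"
    if "mset (zs @ c # d # ws) = mset (xs @ ys)" "P (b # zs @ c # d # ws)" for zs c d ws
  proof -
    have "mset ((b # zs) @ c # d # ws) = mset u"
      using that(1) s by simp
    from Cons.prems(3)[OF this] that(2) show ?thesis by simp
  qed
  moreover have "mset (xs @ ys) = mset v"
    using Cons.prems(1) s by simp
  ultimately show ?case
    \<comment> \<open>The predicate for the tails keeps the letter \<open>b\<close> in
      front.\<close>
    by (rule Cons.IH[of "xs @ ys" "\<lambda>w. P (b # w)", rotated])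
qed simp

section \<open>Propagation of zeros\<close>

lemma bond_rate_nonneg:
  assumes "0 \<le> p" "0 \<le> q"
  shows "0 \<le> bond_rate p q a b"
  using assms by (cases a; cases b) simp_all

text \<open>At a zero of \<open>d\<close> the outflow vanishes, so the nonnegative inflow terms sum
  to 0 and each of them is 0.\<close>

lemma zero_at_predecessor:
  assumes "0 \<le> p" "0 \<le> q"
    and nonneg: "\<And>\<sigma>. \<sigma> \<in> configs L n \<Longrightarrow> 0 \<le> d \<sigma>"
    and "\<tau> \<in> configs L n" "net_flow p q d \<tau> = 0" "d \<tau> = 0" "i < L"
    and "0 < bond_rate p q (\<tau> ! next_site L i) (\<tau> ! i)"
  shows "d (exchange i \<tau>) = 0"
proof -
  have len: "length \<tau> = L" using assms(4) by (rule length_configs)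
  let ?t = "\<lambda>i. d (exchange i \<tau>) * bond_rate p q (\<tau> ! next_site L i) (\<tau> ! i)"
  have "(\<Sum>i<L. ?t i) = 0"
    using assms(5,6) by (simp add: net_flow_def len)
  moreover have "\<forall>i\<in>{..<L}. 0 \<le> ?t i"
    using assms by (auto intro!: mult_nonneg_nonneg bond_rate_nonneg nonneg exchange_in_configs)
  ultimately have "?t i = 0"
    using \<open>i < L\<close> by (subst (asm) sum_nonneg_eq_0_iff) auto
  thus ?thesis using assms(8) by simp
qed

lemma nonneg_stationary_zero:
  assumes pq: "0 \<le> p" "0 \<le> q"
    and nonneg: "\<And>\<sigma>. \<sigma> \<in> configs L n \<Longrightarrow> 0 \<le> d \<sigma>"
    and stat: "\<And>\<sigma>. \<sigma> \<in> configs L n \<Longrightarrow> net_flow p q d \<sigma> = 0"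
    and move: "0 < p \<and> n + 1 < L \<or> (\<forall>\<sigma>\<in>configs L n. d (rotate1 \<sigma>) = d \<sigma>)"
    and "\<tau> \<in> configs L n" "d \<tau> = 0" and "\<sigma> \<in> configs L n"
  shows "d \<sigma> = 0"
proof -
  \<comment> \<open>\<open>k\<close> fixes the site of the tracer and \<open>u\<close> is the rest
    of the ring read from there. Bulk exchanges change \<open>u\<close>; \<open>step\<close> raises
    \<open>k\<close> by one.\<close>
  define Z where "Z k u \<longleftrightarrow> d (rotate k (Tracer # u)) = 0" for k u
  define U where "U = {u. Tracer # u \<in> configs L n}"
  have U: "Tracer \<notin> set u" if "u \<in> U" for u
    using that by (auto simp: U_def configs_def count_list_0_iff)
  have U_mset: "v \<in> U \<longleftrightarrow> u \<in> U" if "mset v = mset u" for u v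
    unfolding U_def using in_configs_cong_mset[of "Tracer # v" "Tracer # u"] that by simp
  \<comment> \<open>The function \<open>d \<circ> rotate k\<close> is again nonnegative with zero
    net flow, so predecessors can be computed with the tracer in front.\<close>
  have pred: "d (rotate k (exchange i \<rho>)) = 0"
    if "d (rotate k \<rho>) = 0" "\<rho> \<in> configs L n" "i < L"
      "0 < bond_rate p q (\<rho> ! next_site L i) (\<rho> ! i)" for k i \<rho>
  proof -
    have "net_flow p q (d \<circ> rotate k) \<rho> = 0"
      using stat that(2) by (simp add: rotate_in_configs flip: net_flow_rotate)
    thus ?thesis
      using zero_at_predecessor[OF pq, of L n "d \<circ> rotate k" \<rho> i] nonneg that
      by (simp add: rotate_in_configs)
  qed
  have swap: "Z k (xs @ b # a # ys)" if "xs @ a # b # ys \<in> U" "Z k (xs @ a # b # ys)" for k xs a b ys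
  proof (cases "a = b")
    case False
    let ?\<rho> = "Tracer # xs @ a # b # ys"
    have "a \<noteq> Tracer" "b \<noteq> Tracer" using U[OF that(1)] by auto
    with False have "0 < bond_rate p q b a" by (cases a; cases b) simp_all
    moreover have \<rho>: "?\<rho> \<in> configs L n" using that(1) by (simp add: U_def)
    moreover have L: "L = length xs + length ys + 3" using length_configs[OF \<rho>] by simp
    moreover from L have "next_site L (Suc (length xs)) = Suc (Suc (length xs))"
      by (simp add: next_site_def)
    ultimately have "d (rotate k (exchange (Suc (length xs)) ?\<rho>)) = 0"
      using that(2) by (intro pred) (simp_all add: Z_def nth_append)
    moreover have "exchange (Suc (length xs)) ?\<rho> = Tracer # xs @ b # a # ys"
      using exchange_append[of "Tracer # xs" a b ys] by simp
    ultimately show ?thesis by (simp add: Z_def)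
  qed (use that in simp)
  have connect: "Z k v" if "u \<in> U" "v \<in> U" "Z k u" for k u v
  proof (rule mset_eq_adjacent_swaps[of u v "Z k"])
    show "mset u = mset v"
      using configs_mset_eq[of "Tracer # u" L n "Tracer # v"] that by (simp add: U_def)
  qed (use that swap U_mset in blast)+
  have step: "\<exists>v\<in>U. Z (Suc k) v" if u: "u \<in> U" "Z k u" for k u
    using move
  proof
    assume p: "0 < p \<and> n + 1 < L"
    \<comment> \<open>Bring a vacancy to the end of the word. The predecessor across the closing
      bond has the tracer one site further back, from where it hops forward at rate
      \<open>p\<close>.\<close>
    have "Vacancy \<in> set u"
      using u(1) p by (auto simp: U_def configs_def intro: ccontr)
    then obtain xs ys where s: "u = xs @ Vacancy # ys" by (auto dest: split_list)
    let ?v = "xs @ ys"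
    let ?\<rho> = "Tracer # ?v @ [Vacancy]"
    have v: "?v @ [Vacancy] \<in> U" "Vacancy # ?v \<in> U"
      using u(1) U_mset[of "?v @ [Vacancy]" u] U_mset[of "Vacancy # ?v" u] s by simp_all
    have \<rho>: "?\<rho> \<in> configs L n" using v(1) by (simp add: U_def)
    have L: "L = length ?v + 2" using length_configs[OF \<rho>] by simp
    have "Z k (?v @ [Vacancy])" by (rule connect[OF u(1) v(1) u(2)])
    moreover have "next_site L (Suc (length ?v)) = 0" by (simp add: L next_site_def)
    moreover have "?\<rho> ! Suc (length ?v) = Vacancy"
      by (simp only: nth_Cons_Suc nth_append_length)
    ultimately have "d (rotate k (exchange (Suc (length ?v)) ?\<rho>)) = 0"
      using p L \<rho> by (intro pred) (simp_all add: Z_def)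
    hence "Z (Suc k) (Vacancy # ?v)"
      unfolding exchange_last by (simp add: Z_def rotate1_rotate_swap)
    thus ?thesis using v(2) by blast
  next
    assume "\<forall>\<sigma>\<in>configs L n. d (rotate1 \<sigma>) = d \<sigma>"
    thus ?thesis using u by (intro bexI[of _ u]) (simp_all add: Z_def U_def rotate_in_configs)
  qed
  obtain k u where k: "\<tau> = rotate k (Tracer # u)" "Tracer # u \<in> configs L n"
    using configs_obtain_rotate[OF \<open>\<tau> \<in> configs L n\<close>] by metis
  have all: "\<exists>v\<in>U. Z (k + j) v" for j
  proof (induction j)
    case 0
    show ?case using k \<open>d \<tau> = 0\<close> by (auto simp: Z_def U_def)
  next
    case (Suc j)
    thus ?case using step by auto
  qed
  obtain l v where l: "\<sigma> = rotate l (Tracer # v)" "Tracer # v \<in> configs L n"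
    using configs_obtain_rotate[OF \<open>\<sigma> \<in> configs L n\<close>] by metis
  have "L > 0" using length_configs[OF l(2)] by auto
  \<comment> \<open>Since \<open>step\<close> only raises \<open>k\<close>, the target
    \<open>l\<close> is increased by a multiple of \<open>L\<close>, which does not change the
    rotation.\<close>
  hence "k \<le> l + k * L" by (cases L) auto
  then obtain j where j: "l + k * L = k + j" by (auto simp: le_iff_add)
  have "Z (l + k * L) v"
    using all[of j] connect l(2) unfolding j U_def by blast
  moreover have "rotate (l + k * L) (Tracer # v) = \<sigma>"
    using length_configs[OF l(2)] l(1) rotate_conv_mod[of "l + k * L" "Tracer # v"]
      rotate_conv_mod[of l "Tracer # v"] by simp
  ultimately show ?thesis by (simp add: Z_def)
qed

section \<open>Comparison of a stationary law with the weights\<close>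

lemma stationary_distribution_eq_weight:
  assumes pq: "0 \<le> p" "0 \<le> q"
    and stat: "stationary_distribution L n p q \<pi>"
    and move: "0 < p \<and> n + 1 < L \<or> translation_invariant L n \<pi>"
    and \<tau>: "\<tau> \<in> configs L n"
  shows "pmf \<pi> \<tau> = weight p q \<tau> / partition_function L n p q"
proof -
  let ?C = "configs L n"
  define h where "h \<sigma> = pmf \<pi> \<sigma> / weight p q \<sigma>" for \<sigma>
  define M where "M = Max (h ` ?C)"
  define d where "d \<sigma> = M * weight p q \<sigma> - pmf \<pi> \<sigma>" for \<sigma>
  note w = weight_pos[OF pq]
  have "M \<in> h ` ?C"
    unfolding M_def using \<tau> finite_configs by (intro Max_in) auto
  then obtain \<rho> where \<rho>: "\<rho> \<in> ?C" "d \<rho> = 0"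
    using w by (auto simp: h_def d_def less_imp_neq[symmetric])
  have nonneg: "0 \<le> d \<sigma>" if "\<sigma> \<in> ?C" for \<sigma>
  proof -
    have "h \<sigma> \<le> M" unfolding M_def using that finite_configs by (intro Max_ge) auto
    thus ?thesis using w by (simp add: h_def d_def pos_divide_le_eq)
  qed
  have "net_flow p q d \<sigma> = 0" if "\<sigma> \<in> ?C" for \<sigma>
  proof -
    have "net_flow p q (pmf \<pi>) \<sigma> = 0"
      using that stat sum_generator_eq_net_flow[OF that, of "pmf \<pi>" p q]
      by (simp add: stationary_distribution_def)
    thus ?thesis
      unfolding d_def by (simp add: net_flow_linear net_flow_weight[OF that])
  qed
  moreover have "0 < p \<and> n + 1 < L \<or> (\<forall>\<sigma>\<in>?C. d (rotate1 \<sigma>) = d \<sigma>)"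
    using move by (auto simp: translation_invariant_def d_def weight_rotate1)
  ultimately have eq: "pmf \<pi> \<sigma> = M * weight p q \<sigma>" if "\<sigma> \<in> ?C" for \<sigma>
    using nonneg_stationary_zero[of p q L n d \<rho> \<sigma>] pq nonneg \<rho> that by (simp add: d_def)
  \<comment> \<open>Total mass 1 determines \<open>M\<close> and also shows that the partition
    function is nonzero.\<close>
  have "1 = (\<Sum>\<sigma>\<in>?C. pmf \<pi> \<sigma>)"
    using stat finite_configs by (simp add: stationary_distribution_def sum_pmf_eq_1)
  also have "\<dots> = M * partition_function L n p q"
    by (simp add: eq partition_function_def sum_distrib_left)
  finally have "M = 1 / partition_function L n p q"
    by (metis eq_divide_imp mult_zero_right zero_neq_one)
  thus ?thesis
    using eq[OF \<tau>] by simp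
qed

theorem theorem2p4:
  fixes L n :: nat and p q :: real and \<pi> :: "letter list pmf" and \<tau> :: "letter list"
  assumes "0 \<le> q" and "q \<le> p" and "p \<le> 1"
    and "stationary_distribution L n p q \<pi>"
    and "p = 0 \<or> n + 1 = L \<Longrightarrow> translation_invariant L n \<pi>"
    and "\<tau> \<in> configs L n" and "hd \<tau> = Tracer"
  shows "pmf \<pi> \<tau> = weight p q \<tau> / partition_function L n p q"
proof (rule stationary_distribution_eq_weight)
  show "0 < p \<and> n + 1 < L \<or> translation_invariant L n \<pi>"
  \<comment> \<open>If \<open>p = 0\<close>, then \<open>q = 0\<close> and the tracer is frozen; if
    \<open>n + 1 = L\<close>, there is no vacancy and nothing moves. There translation invariance
    has to link the tracer positions.\<close>
  proof (cases "p = 0 \<or> n + 1 = L")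
    case False
    moreover have "n + 1 \<le> L" using assms(6) by (simp add: configs_def)
    ultimately show ?thesis using assms(1,2) by auto
  qed (use assms(5) in blast)
qed (use assms in auto)

end
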